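(* Let $(\mathfrak{g},[\cdot,\cdot],\omega)$ be a symplectic Lie algebra over $\mathbb{K}$, let $\bullet$ be its Levi-Civita product, and let $\cdot$ be the left-symmetric product associated with $(\mathfrak{g},[\cdot,\cdot],\omega)$. Then the following assertions are equivalent: (1) $(\mathfrak{g},\bullet)$ is a left-symmetric algebra; (2) $(\mathfrak{g},\bullet)$ is a left-symmetric $\mathrm{L}$-algebra; (3) $(\mathfrak{g},\cdot)$ is a Novikov algebra; (4) $(\mathfrak{g},\cdot)$ and $(\mathfrak{g},\bullet)$ are associative algebras.
   Context: $\mathbb{K}$ is a field of characteristic $0$; all vector spaces are finite-dimensional. A symplectic Lie algebra is a Lie algebra $\mathfrak{g}$ with a nondegenerate skew-symmetric bilinear form $\omega$ satisfying $\omega([u,v],w)+\omega([v,w],u)+\omega([w,u],v)=0$ for all $u,v,w$. The Levi-Civita product is the unique bilinear product $\bullet$ with $u\bullet v-v\bullet u=[u,v]$ and $\omega(u\bullet v,w)=\omega(v,u\bullet w)$; equivalently $2\omega(u\bullet v,w)=\omega([u,v],w)-\omega([v,w],u)+\omega([w,u],v)$. The left-symmetric product associated with the symplectic Lie algebra is the product $\cdot$ defined by $\omega(u\cdot v,w)=-\omega(v,[u,w])$ for all $u,v,w$. For a product $\bullet$ with associator $(u,v,w)=(u\bullet v)\bullet w-u\bullet(v\bullet w)$: left-symmetric means $(u,v,w)=(v,u,w)$; an $\mathrm{L}$-algebra satisfies $u\bullet(v\bullet w)=v\bullet(u\bullet w)$; a left-symmetric $\mathrm{L}$-algebra is both; Novikov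 means left-symmetric and $(u\bullet v)\bullet w=(u\bullet w)\bullet v$, for all $u,v,w$. *)

theory Defs
  imports Complex_Main
begin

definition bilinear_map ::
  "('k::field \<Rightarrow> 'a::ab_group_add \<Rightarrow> 'a) \<Rightarrow> ('k \<Rightarrow> 'b::ab_group_add \<Rightarrow> 'b) \<Rightarrow> ('a \<Rightarrow> 'a \<Rightarrow> 'b) \<Rightarrow> bool"
where
  "bilinear_map s t f \<longleftrightarrow>
     (\<forall>x. Vector_Spaces.linear s t (\<lambda>y. f x y)) \<and> (\<forall>y. Vector_Spaces.linear s t (\<lambda>x. f x y))"

locale lie_algebra = vector_space scale
  for scale :: "'k::field \<Rightarrow> 'v::ab_group_add \<Rightarrow> 'v" +
  fixes bracket :: "'v \<Rightarrow> 'v \<Rightarrow> 'v"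
  assumes bracket_bilinear: "bilinear_map scale scale bracket"
    and bracket_self: "bracket u u = 0"
    and jacobi: "bracket u (bracket v w) + bracket v (bracket w u) + bracket w (bracket u v) = 0"

text \<open>\<^term>\<open>Basis\<close> is the arbitrary finite basis by which the library locale
  \<^locale>\<open>finite_dimensional_vector_space\<close> expresses finite dimensionality;
  none of the notions below depends on it.\<close>

locale symplectic_lie_algebra =
  lie_algebra scale bracket + finite_dimensional_vector_space scale Basis
  for scale :: "'k::field_char_0 \<Rightarrow> 'v::ab_group_add \<Rightarrow> 'v"
    and Basis :: "'v set"
    and bracket :: "'v \<Rightarrow> 'v \<Rightarrow> 'v" +
  fixes \<omega> :: "'v \<Rightarrow> 'v \<Rightarrow> 'k"
  assumes form_bilinear: "bilinear_map scale (*) \<omega>"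
    and form_skew: "\<omega> u v = - \<omega> v u"
    and form_nondegenerate: "(\<And>v. \<omega> u v = 0) \<Longrightarrow> u = 0"
    and form_closed: "\<omega> (bracket u v) w + \<omega> (bracket v w) u + \<omega> (bracket w u) v = 0"

definition is_levi_civita_product ::
  "('k::field \<Rightarrow> 'v::ab_group_add \<Rightarrow> 'v) \<Rightarrow> ('v \<Rightarrow> 'v \<Rightarrow> 'v) \<Rightarrow> ('v \<Rightarrow> 'v \<Rightarrow> 'k) \<Rightarrow> ('v \<Rightarrow> 'v \<Rightarrow> 'v) \<Rightarrow> bool"
where
  "is_levi_civita_product scale bracket \<omega> p \<longleftrightarrow>
     bilinear_map scale scale p \<and>
     (\<forall>u v. p u v - p v u = bracket u v) \<and>
     (\<forall>u v w. \<omega> (p u v) w = \<omega> v (p u w))"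

text \<open>The two definite descriptions below are justified by the existence and uniqueness
  lemmas proved at the end of this theory.\<close>

definition levi_civita_product ::
  "('k::field \<Rightarrow> 'v::ab_group_add \<Rightarrow> 'v) \<Rightarrow> ('v \<Rightarrow> 'v \<Rightarrow> 'v) \<Rightarrow> ('v \<Rightarrow> 'v \<Rightarrow> 'k) \<Rightarrow> 'v \<Rightarrow> 'v \<Rightarrow> 'v"
where
  "levi_civita_product scale bracket \<omega> = (THE p. is_levi_civita_product scale bracket \<omega> p)"

definition left_symmetric_product ::
  "('v::ab_group_add \<Rightarrow> 'v \<Rightarrow> 'v) \<Rightarrow> ('v \<Rightarrow> 'v \<Rightarrow> 'k::field) \<Rightarrow> 'v \<Rightarrow> 'v \<Rightarrow> 'v"
where
  "left_symmetric_product bracket \<omega> u v = (THE x. \<forall>w. \<omega> x w = - \<omega> v (bracket u w))"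

definition associator :: "('v::ab_group_add \<Rightarrow> 'v \<Rightarrow> 'v) \<Rightarrow> 'v \<Rightarrow> 'v \<Rightarrow> 'v \<Rightarrow> 'v" where
  "associator p u v w = p (p u v) w - p u (p v w)"

definition left_symmetric :: "('v::ab_group_add \<Rightarrow> 'v \<Rightarrow> 'v) \<Rightarrow> bool" where
  "left_symmetric p \<longleftrightarrow> (\<forall>u v w. associator p u v w = associator p v u w)"

definition L_algebra :: "('v::ab_group_add \<Rightarrow> 'v \<Rightarrow> 'v) \<Rightarrow> bool" where
  "L_algebra p \<longleftrightarrow> (\<forall>u v w. p u (p v w) = p v (p u w))"

definition left_symmetric_L_algebra :: "('v::ab_group_add \<Rightarrow> 'v \<Rightarrow> 'v) \<Rightarrow> bool" where
  "left_symmetric_L_algebra p \<longleftrightarrow> left_symmetric p \<and> L_algebra p"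

definition novikov :: "('v::ab_group_add \<Rightarrow> 'v \<Rightarrow> 'v) \<Rightarrow> bool" where
  "novikov p \<longleftrightarrow> left_symmetric p \<and> (\<forall>u v w. p (p u v) w = p (p u w) v)"

definition associative :: "('v::ab_group_add \<Rightarrow> 'v \<Rightarrow> 'v) \<Rightarrow> bool" where
  "associative p \<longleftrightarrow> (\<forall>u v w. associator p u v w = 0)"

lemma bilinear_map_iff:
  assumes "vector_space s" "vector_space t"
  shows "bilinear_map s t f \<longleftrightarrow>
    (\<forall>x y z. f (x + y) z = f x z + f y z) \<and> (\<forall>x y z. f x (y + z) = f x y + f x z) \<and>
    (\<forall>c x y. f (s c x) y = t c (f x y)) \<and> (\<forall>c x y. f x (s c y) = t c (f x y))"
  unfolding bilinear_map_def Vector_Spaces.linear_iff using assms by blast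

context symplectic_lie_algebra
begin

lemma vs_mult: "vector_space ((*) :: 'k \<Rightarrow> 'k \<Rightarrow> 'k)"
  by unfold_locales (auto simp: algebra_simps)

lemmas form_lin = form_bilinear[unfolded bilinear_map_iff[OF vector_space_axioms vs_mult]]
lemmas bracket_lin =
  bracket_bilinear[unfolded bilinear_map_iff[OF vector_space_axioms vector_space_axioms]]

lemma form_simps:
  "\<omega> (x + y) z = \<omega> x z + \<omega> y z" "\<omega> x (y + z) = \<omega> x y + \<omega> x z"
  "\<omega> (scale c x) y = c * \<omega> x y" "\<omega> x (scale c y) = c * \<omega> x y"
  using form_lin by blast+

lemma bracket_simps:
  "bracket (x + y) z = bracket x z + bracket y z" "bracket x (y + z) = bracket x y + bracket x z"
  "bracket (scale c x) y = scale c (bracket x y)" "bracket x (scale c y) = scale c (bracket x y)"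
  using bracket_lin by blast+

lemma form_0: "\<omega> 0 x = 0" "\<omega> x 0 = 0"
  using form_simps(1)[of 0 0 x] form_simps(2)[of x 0 0] by simp_all

lemma form_minus: "\<omega> (- x) y = - \<omega> x y" "\<omega> x (- y) = - \<omega> x y"
  using form_simps(1)[of x "- x" y] form_simps(2)[of x y "- y"]
  by (simp_all add: form_0 eq_neg_iff_add_eq_0 add.commute)

lemma form_diff: "\<omega> (x - y) z = \<omega> x z - \<omega> y z" "\<omega> x (y - z) = \<omega> x y - \<omega> x z"
  using form_simps(1)[of x "- y" z] form_simps(2)[of x y "- z"] by (simp_all add: form_minus)

lemma form_eqI: "(\<And>w. \<omega> x w = \<omega> y w) \<Longrightarrow> x = y"
  using form_nondegenerate[of "x - y"] by (simp add: form_diff)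

lemma bracket_skew: "bracket u v = - bracket v u"
proof -
  have "bracket u v + bracket v u = bracket (u + v) (u + v)"
    by (simp only: bracket_simps) (simp add: bracket_self)
  then have "bracket u v + bracket v u = 0" by (simp only: bracket_self)
  then show ?thesis by (simp add: eq_neg_iff_add_eq_0)
qed

lemma form_represents:
  assumes add: "\<And>x y. f (x + y) = f x + f y" and sc: "\<And>c x. f (scale c x) = c * f x"
  shows "\<exists>!x. \<forall>w. \<omega> x w = f w"
proof -
  have f0: "f 0 = 0" using add[of 0 0] by simp
  define T where "T = (\<lambda>x. \<Sum>b\<in>Basis. scale (\<omega> x b) b)"
  have coords: "g b = h b"
    if "(\<Sum>b\<in>Basis. scale (g b) b) = (\<Sum>b\<in>Basis. scale (h b) b)" "b \<in> Basis" for g h b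
  proof -
    have *: "(\<Sum>b\<in>Basis. scale (g b - h b) b) = 0"
      using that(1) by (simp add: scale_left_diff_distrib sum_subtractf)
    have "(\<lambda>b. g b - h b) b = 0"
      by (rule independentD[OF independent_Basis finite_Basis subset_refl * that(2)])
    then show ?thesis by simp
  qed
  have extend: "(\<forall>w. \<omega> x w = g w)"
    if "\<And>x y. g (x + y) = g x + g y" "\<And>c x. g (scale c x) = c * g x" "g 0 = 0"
      "\<forall>b\<in>Basis. \<omega> x b = g b" for x g
  proof
    fix w
    have "w \<in> span Basis" by (simp add: span_Basis)
    then show "\<omega> x w = g w"
      by (induction rule: span_induct_alt) (use that in \<open>auto simp: form_0 form_simps\<close>)
  qed
  have lin: "Vector_Spaces.linear scale scale T"
    unfolding Vector_Spaces.linear_iff T_def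
    by (simp add: vector_space_axioms form_simps scale_left_distrib sum.distrib scale_sum_right)
  have "inj T"
  proof (rule injI)
    fix x y assume "T x = T y"
    then have "\<forall>b\<in>Basis. \<omega> x b = \<omega> y b" unfolding T_def using coords by blast
    then have "\<forall>w. \<omega> x w = \<omega> y w"
      by (intro extend[of "\<omega> y"]) (simp_all add: form_simps form_0)
    then show "x = y" using form_eqI by blast
  qed
  then have "surj T" by (rule linear_inj_imp_surj[OF lin])
  then obtain x where "T x = (\<Sum>b\<in>Basis. scale (f b) b)" by (metis surjD)
  then have "\<forall>b\<in>Basis. \<omega> x b = f b" unfolding T_def using coords by blast
  then have "\<forall>w. \<omega> x w = f w" by (intro extend[of f] add sc f0)
  then show ?thesis using form_eqI by metis
qed

lemma left_symmetric_product_ex1: "\<exists>!x. \<forall>w. \<omega> x w = - \<omega> v (bracket u w)"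
  by (rule form_represents) (simp_all add: form_simps bracket_simps)

lemma left_symmetric_product:
  "\<omega> (left_symmetric_product bracket \<omega> u v) w = - \<omega> v (bracket u w)"
  using theI'[OF left_symmetric_product_ex1[of v u]] by (simp add: left_symmetric_product_def)

lemma left_symmetric_product_bilinear:
  "bilinear_map scale scale (left_symmetric_product bracket \<omega>)"
  unfolding bilinear_map_iff[OF vector_space_axioms vector_space_axioms]
  by (intro conjI allI; rule form_eqI)
    (simp_all add: left_symmetric_product form_simps bracket_simps)

lemma levi_civita_koszul:
  assumes "is_levi_civita_product scale bracket \<omega> p"
  shows "2 * \<omega> (p u v) w = \<omega> (bracket u v) w - \<omega> (bracket v w) u + \<omega> (bracket w u) v"
proof -
  have tor: "bracket x y = p x y - p y x"
    and adj: "\<omega> (p x y) z = \<omega> y (p x z)" for x y z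
    using assms by (simp_all add: is_levi_civita_product_def)
  have alt: "\<omega> (p x y) z = - \<omega> (p x z) y" for x y z
    using adj[of x y z] form_skew[of y "p x z"] by simp
  show ?thesis
    using alt[of u v w] alt[of v w u] alt[of w u v]
    by (simp add: tor form_diff)
qed

lemma levi_civita_product_ex1: "\<exists>!p. is_levi_civita_product scale bracket \<omega> p"
proof (rule ex_ex1I)
  define K where
    "K u v w = (\<omega> (bracket u v) w - \<omega> (bracket v w) u + \<omega> (bracket w u) v) / 2" for u v w
  define p where "p u v = (THE x. \<forall>w. \<omega> x w = K u v w)" for u v
  have "\<exists>!x. \<forall>w. \<omega> x w = K u v w" for u v
    by (rule form_represents) (simp_all add: K_def form_simps bracket_simps field_simps)
  from theI'[OF this] have p: "\<omega> (p u v) w = K u v w" for u v w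
    by (simp add: p_def)
  have "bilinear_map scale scale p"
    unfolding bilinear_map_iff[OF vector_space_axioms vector_space_axioms]
    by (intro conjI allI; rule form_eqI)
      (simp_all add: p K_def form_simps bracket_simps field_simps)
  moreover have "p u v - p v u = bracket u v" for u v
  proof (rule form_eqI)
    fix w
    have "\<omega> (bracket v u) w = - \<omega> (bracket u v) w" "\<omega> (bracket u w) v = - \<omega> (bracket w u) v"
      "\<omega> (bracket w v) u = - \<omega> (bracket v w) u"
      by (subst bracket_skew, simp add: form_minus)+
    then show "\<omega> (p u v - p v u) w = \<omega> (bracket u v) w"
      by (simp add: form_diff p K_def field_simps)
  qed
  moreover have "\<omega> (p u v) w = \<omega> v (p u w)" for u v w
  proof -
    have "\<omega> (bracket w v) u = - \<omega> (bracket v w) u" "\<omega> (bracket u w) v = - \<omega> (bracket w u) v"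
      "\<omega> (bracket v u) w = - \<omega> (bracket u v) w"
      by (subst bracket_skew, simp add: form_minus)+
    then show ?thesis
      by (subst form_skew[of v]) (simp add: p K_def field_simps)
  qed
  ultimately show "\<exists>p. is_levi_civita_product scale bracket \<omega> p"
    by (auto simp: is_levi_civita_product_def)
next
  fix p q
  assume pq: "is_levi_civita_product scale bracket \<omega> p" "is_levi_civita_product scale bracket \<omega> q"
  show "p = q"
  proof (intro ext, rule form_eqI)
    fix u v w
    have "2 * \<omega> (p u v) w = 2 * \<omega> (q u v) w"
      using pq[THEN levi_civita_koszul] by simp
    then show "\<omega> (p u v) w = \<omega> (q u v) w" by simp
  qed
qed

lemma levi_civita_product:
  "is_levi_civita_product scale bracket \<omega> (levi_civita_product scale bracket \<omega>)"
  unfolding levi_civita_product_def by (rule theI'[OF levi_civita_product_ex1])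

end

end

theory Submission
  imports Defs
begin

text \<open>
  Write \<open>L\<close> and \<open>R\<close> for left and right multiplication in the left-symmetric product \<open>\<cdot>\<close>, and
  \<open>*\<close> for the adjoint with respect to \<open>\<omega>\<close>. Closedness of \<open>\<omega>\<close> turns the Koszul formula into
  \<open>u \<bullet> v = - v \<cdot> u\<close> (\<open>levi_civita_eq\<close>): up to sign, \<open>\<bullet>\<close> is the opposite of \<open>\<cdot>\<close>. Thus each
  condition on \<open>\<bullet>\<close> is one on \<open>\<cdot>\<close>, and the metric condition on \<open>\<bullet>\<close> says \<open>R\<^sub>u\<^sup>* = R\<^sub>u\<close>. The product
  \<open>\<cdot>\<close> is left-symmetric in every symplectic Lie algebra, because \<open>L\<close> is the representation dual
  to the adjoint one. The Novikov condition on \<open>\<cdot>\<close> and the \<open>L\<close>-algebra condition on \<open>\<bullet>\<close> therefore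
  both say that the operators \<open>R\<^sub>u\<close> commute with each other, and the two products are associative
  simultaneously.

  What remains is obtained by taking adjoints.
  If \<open>\<bullet>\<close> is left-symmetric, then the commutator of \<open>R\<^sub>u\<close> and \<open>R\<^sub>v\<close> equals \<open>R\<close> at \<open>[v,u]\<close>; the
  former is skew-adjoint and the latter self-adjoint, so both vanish.
  If \<open>\<cdot>\<close> is associative, then \<open>R\<close> at \<open>u \<cdot> v\<close> is \<open>R\<^sub>v R\<^sub>u\<close>, whose adjoint is \<open>R\<^sub>u R\<^sub>v\<close>; so the
  right multiplications commute.
  If \<open>\<cdot>\<close> is Novikov, then \<open>L\<close> at \<open>u \<cdot> v\<close> is \<open>R\<^sub>v L\<^sub>u\<close>, and the adjoint of this identity, combined
  with left-symmetry, gives associativity. Then \<open>\<bullet>\<close> is associative as well, in particular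
  left-symmetric.
\<close>

context symplectic_lie_algebra
begin

abbreviation lsp :: "'v \<Rightarrow> 'v \<Rightarrow> 'v" (infixl "\<cdot>" 70)
  where "u \<cdot> v \<equiv> left_symmetric_product bracket \<omega> u v"

abbreviation lcp :: "'v \<Rightarrow> 'v \<Rightarrow> 'v" (infixl "\<bullet>" 70)
  where "u \<bullet> v \<equiv> levi_civita_product scale bracket \<omega> u v"

lemma double_cancel:
  fixes x y :: 'v
  assumes "x + x = y + y"
  shows "x = y"
proof (rule form_eqI)
  fix w
  have "\<omega> (x + x) w = \<omega> (y + y) w"
    using assms by simp
  then have "2 * \<omega> x w = 2 * \<omega> y w"
    by (simp add: form_simps)
  then show "\<omega> x w = \<omega> y w" by simp
qed

lemmas lsp_lin =
  left_symmetric_product_bilinear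
    [unfolded bilinear_map_iff[OF vector_space_axioms vector_space_axioms]]

lemma lsp_add:
  "(x + y) \<cdot> z = x \<cdot> z + y \<cdot> z" "x \<cdot> (y + z) = x \<cdot> y + x \<cdot> z"
  using lsp_lin by blast+

lemma lsp_minus: "(- x) \<cdot> y = - (x \<cdot> y)" "x \<cdot> (- y) = - (x \<cdot> y)"
proof -
  have "0 \<cdot> y = 0" "x \<cdot> 0 = 0"
    using lsp_add(1)[of 0 0 y] lsp_add(2)[of x 0 0] by simp_all
  then show "(- x) \<cdot> y = - (x \<cdot> y)" "x \<cdot> (- y) = - (x \<cdot> y)"
    using lsp_add(1)[of x "- x" y] lsp_add(2)[of x y "- y"]
    by (simp_all add: eq_neg_iff_add_eq_0 add.commute)
qed

lemma lsp_diff: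
  "(x - y) \<cdot> z = x \<cdot> z - y \<cdot> z" "x \<cdot> (y - z) = x \<cdot> y - x \<cdot> z"
  using lsp_add(1)[of x "- y" z] lsp_add(2)[of x y "- z"] by (simp_all add: lsp_minus)

text \<open>By closedness, the first and third terms of the Koszul formula add up to the second, which
  leaves \<open>\<omega> (u \<bullet> v) w = - \<omega> [v,w] u\<close>; this is the defining relation of \<open>v \<cdot> u\<close> up to sign.\<close>

lemma levi_civita_eq: "u \<bullet> v = - (v \<cdot> u)"
proof (rule form_eqI)
  fix w
  have "2 * \<omega> (u \<bullet> v) w = \<omega> (bracket u v) w - \<omega> (bracket v w) u + \<omega> (bracket w u) v"
    by (rule levi_civita_koszul[OF levi_civita_product])
  also have "\<dots> = - (2 * \<omega> (bracket v w) u)"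
    using form_closed[of u v w] by algebra
  also have "\<dots> = 2 * \<omega> (- (v \<cdot> u)) w"
    using form_skew[of u "bracket v w"] by (simp add: form_minus left_symmetric_product)
  finally show "\<omega> (u \<bullet> v) w = \<omega> (- (v \<cdot> u)) w" by simp
qed

lemma lsp_commutator: "u \<cdot> v - v \<cdot> u = bracket u v"
proof -
  have "u \<bullet> v - v \<bullet> u = bracket u v"
    using levi_civita_product by (simp add: is_levi_civita_product_def)
  then show ?thesis by (simp add: levi_civita_eq)
qed

text \<open>This is the metric condition on \<open>\<bullet>\<close>, whose left multiplications are \<open>- R\<^sub>u\<close>.\<close>

lemma right_mult_self_adjoint: "\<omega> (x \<cdot> u) y = \<omega> x (y \<cdot> u)"
proof -
  have "\<omega> (u \<bullet> x) y = \<omega> x (u \<bullet> y)"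
    using levi_civita_product by (simp add: is_levi_civita_product_def)
  then show ?thesis by (simp add: levi_civita_eq form_minus)
qed

lemma left_mult_adjoint: "\<omega> (u \<cdot> x) y = \<omega> x (y \<cdot> u - u \<cdot> y)"
  using lsp_commutator[of y u]
  by (simp add: left_symmetric_product bracket_skew[of u y] form_minus)

text \<open>Since \<open>L\<close> is minus the adjoint of \<open>ad\<close>, the Jacobi identity makes it a representation; with
  \<open>[u,v] = u \<cdot> v - v \<cdot> u\<close> this is left-symmetry.\<close>

lemma lsp_left_symmetric: "left_symmetric (\<cdot>)"
proof -
  have rep: "bracket u v \<cdot> w = u \<cdot> (v \<cdot> w) - v \<cdot> (u \<cdot> w)" for u v w
  proof (rule form_eqI)
    fix x
    have "bracket v (bracket x u) = - bracket v (bracket u x)"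
      using bracket_simps(2)[of v "bracket x u" "bracket u x"] bracket_simps(2)[of v 0 0]
      by (simp add: bracket_skew[of x u] eq_neg_iff_add_eq_0)
    then have "bracket (bracket u v) x = bracket u (bracket v x) - bracket v (bracket u x)"
      using jacobi[of u v x] bracket_skew[of "bracket u v" x] by (simp add: algebra_simps)
    then show "\<omega> (bracket u v \<cdot> w) x = \<omega> (u \<cdot> (v \<cdot> w) - v \<cdot> (u \<cdot> w)) x"
      by (simp add: left_symmetric_product form_diff)
  qed
  have "(u \<cdot> v) \<cdot> w - (v \<cdot> u) \<cdot> w = u \<cdot> (v \<cdot> w) - v \<cdot> (u \<cdot> w)" for u v w
    using rep[of u v w] by (simp add: lsp_commutator[symmetric] lsp_diff)
  then show ?thesis
    by (simp add: left_symmetric_def associator_def algebra_simps)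
qed

lemma novikov_iff_right_mults_commute:
  "novikov (\<cdot>) \<longleftrightarrow> (\<forall>u v w. (u \<cdot> v) \<cdot> w = (u \<cdot> w) \<cdot> v)"
  using lsp_left_symmetric by (simp add: novikov_def)

lemma L_algebra_iff_novikov: "L_algebra (\<bullet>) \<longleftrightarrow> novikov (\<cdot>)"
  unfolding novikov_iff_right_mults_commute L_algebra_def
  by (simp add: levi_civita_eq lsp_minus) blast

lemma associator_levi_civita: "associator (\<bullet>) u v w = - associator (\<cdot>) w v u"
  by (simp add: associator_def levi_civita_eq lsp_minus)

lemma associative_levi_civita_iff: "associative (\<bullet>) \<longleftrightarrow> associative (\<cdot>)"
  by (auto simp: associative_def associator_levi_civita)

text \<open>Left-symmetry of \<open>\<bullet>\<close> equates the commutator of \<open>R\<^sub>v\<close> and \<open>R\<^sub>u\<close>, which changes sign under the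
  adjoint, with the self-adjoint operator \<open>R\<close> at \<open>[u,v]\<close>.\<close>

lemma novikov_if_levi_civita_left_symmetric:
  assumes "left_symmetric (\<bullet>)"
  shows "novikov (\<cdot>)"
  unfolding novikov_iff_right_mults_commute
proof (intro allI)
  fix x u v
  have comm: "(y \<cdot> u) \<cdot> v - (y \<cdot> v) \<cdot> u = y \<cdot> (u \<cdot> v - v \<cdot> u)" for y
  proof -
    have "associator (\<bullet>) v u y = associator (\<bullet>) u v y"
      using assms by (simp add: left_symmetric_def)
    then have "associator (\<cdot>) y u v = associator (\<cdot>) y v u"
      by (simp add: associator_levi_civita)
    then show ?thesis
      by (simp add: associator_def lsp_diff algebra_simps)
  qed
  have "(x \<cdot> u) \<cdot> v - (x \<cdot> v) \<cdot> u = (x \<cdot> v) \<cdot> u - (x \<cdot> u) \<cdot> v"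
  proof (rule form_eqI)
    fix y
    have "\<omega> ((x \<cdot> u) \<cdot> v - (x \<cdot> v) \<cdot> u) y = \<omega> x (y \<cdot> (u \<cdot> v - v \<cdot> u))"
      by (simp only: comm right_mult_self_adjoint)
    also have "\<dots> = \<omega> ((x \<cdot> v) \<cdot> u - (x \<cdot> u) \<cdot> v) y"
      by (simp only: comm[symmetric] form_diff right_mult_self_adjoint)
    finally show "\<omega> ((x \<cdot> u) \<cdot> v - (x \<cdot> v) \<cdot> u) y = \<omega> ((x \<cdot> v) \<cdot> u - (x \<cdot> u) \<cdot> v) y" .
  qed
  then have "(x \<cdot> u) \<cdot> v + (x \<cdot> u) \<cdot> v = (x \<cdot> v) \<cdot> u + (x \<cdot> v) \<cdot> u"
    by (simp add: algebra_simps)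
  then show "(x \<cdot> u) \<cdot> v = (x \<cdot> v) \<cdot> u"
    by (rule double_cancel)
qed

text \<open>Taking adjoints turns \<open>R\<^sub>v R\<^sub>u\<close> into \<open>R\<^sub>u R\<^sub>v\<close> and fixes \<open>R\<close> at \<open>u \<cdot> v\<close>.\<close>

lemma novikov_if_associative:
  assumes "associative (\<cdot>)"
  shows "novikov (\<cdot>)"
  unfolding novikov_iff_right_mults_commute
proof (intro allI)
  fix x u v
  have assoc: "(y \<cdot> u) \<cdot> v = y \<cdot> (u \<cdot> v)" for y
    using assms by (simp add: associative_def associator_def)
  show "(x \<cdot> u) \<cdot> v = (x \<cdot> v) \<cdot> u"
  proof (rule form_eqI)
    fix y
    have "\<omega> ((x \<cdot> u) \<cdot> v) y = \<omega> x (y \<cdot> (u \<cdot> v))"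
      by (simp only: assoc right_mult_self_adjoint)
    also have "\<dots> = \<omega> ((x \<cdot> v) \<cdot> u) y"
      by (simp only: assoc[symmetric] right_mult_self_adjoint)
    finally show "\<omega> ((x \<cdot> u) \<cdot> v) y = \<omega> ((x \<cdot> v) \<cdot> u) y" .
  qed
qed

text \<open>The adjoint of the identity \<open>(u \<cdot> v) \<cdot> x = (u \<cdot> x) \<cdot> v\<close> in \<open>x\<close> is a second relation between the
  products \<open>y \<cdot> (u \<cdot> v)\<close> and \<open>u \<cdot> (y \<cdot> v)\<close>. Left-symmetry controls their difference and the adjoint
  relation their sum, so each is determined.\<close>

lemma associative_if_novikov:
  assumes "novikov (\<cdot>)"
  shows "associative (\<cdot>)"
proof -
  have comm: "(a \<cdot> b) \<cdot> c = (a \<cdot> c) \<cdot> b" for a b c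
    using assms novikov_iff_right_mults_commute by blast
  have "(y \<cdot> u) \<cdot> v = y \<cdot> (u \<cdot> v)" for y u v
  proof (rule double_cancel)
    have adj: "(y \<cdot> v) \<cdot> u - u \<cdot> (y \<cdot> v) = y \<cdot> (u \<cdot> v) - (u \<cdot> v) \<cdot> y"
    proof (rule form_eqI)
      fix x
      have "\<omega> x ((y \<cdot> v) \<cdot> u - u \<cdot> (y \<cdot> v)) = \<omega> ((u \<cdot> x) \<cdot> v) y"
        by (simp only: right_mult_self_adjoint[of "u \<cdot> x"] left_mult_adjoint[of u x "y \<cdot> v"])
      also have "\<dots> = \<omega> x (y \<cdot> (u \<cdot> v) - (u \<cdot> v) \<cdot> y)"
        by (simp only: comm[of u x v] left_mult_adjoint[of "u \<cdot> v" x y])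
      finally show "\<omega> ((y \<cdot> v) \<cdot> u - u \<cdot> (y \<cdot> v)) x = \<omega> (y \<cdot> (u \<cdot> v) - (u \<cdot> v) \<cdot> y) x"
        by (subst (1 2) form_skew) (rule arg_cong)
    qed
    have ls: "(u \<cdot> y) \<cdot> v - u \<cdot> (y \<cdot> v) = (y \<cdot> u) \<cdot> v - y \<cdot> (u \<cdot> v)"
      using lsp_left_symmetric by (simp add: left_symmetric_def associator_def)
    have "(y \<cdot> u) \<cdot> v + (y \<cdot> u) \<cdot> v
        = ((y \<cdot> v) \<cdot> u - u \<cdot> (y \<cdot> v)) + ((y \<cdot> u) \<cdot> v - y \<cdot> (u \<cdot> v)) + u \<cdot> (y \<cdot> v) + y \<cdot> (u \<cdot> v)"
      by (simp add: comm[of y v u])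
    also have "\<dots> = y \<cdot> (u \<cdot> v) + y \<cdot> (u \<cdot> v)"
      unfolding adj ls[symmetric] comm[of u y v] by simp
    finally show "(y \<cdot> u) \<cdot> v + (y \<cdot> u) \<cdot> v = y \<cdot> (u \<cdot> v) + y \<cdot> (u \<cdot> v)" .
  qed
  then show ?thesis by (simp add: associative_def associator_def)
qed

text \<open>Commuting right multiplications only give the \<open>L\<close>-algebra identity for \<open>\<bullet>\<close> directly; its
  left-symmetry comes by way of associativity, which it shares with \<open>\<cdot>\<close>.\<close>

lemma left_symmetric_L_algebra_levi_civita_iff:
  "left_symmetric_L_algebra (\<bullet>) \<longleftrightarrow> novikov (\<cdot>)"
proof -
  have "left_symmetric (\<bullet>)" if "novikov (\<cdot>)"
    using associative_if_novikov[OF that] associative_levi_civita_iff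
    by (simp add: associative_def left_symmetric_def)
  then show ?thesis
    using L_algebra_iff_novikov by (auto simp: left_symmetric_L_algebra_def)
qed

end

theorem theorem3p3:
  fixes scale :: "'k::field_char_0 \<Rightarrow> 'v::ab_group_add \<Rightarrow> 'v"
    and Basis :: "'v set"
    and bracket :: "'v \<Rightarrow> 'v \<Rightarrow> 'v"
    and \<omega> :: "'v \<Rightarrow> 'v \<Rightarrow> 'k"
  assumes "symplectic_lie_algebra scale Basis bracket \<omega>"
  shows "(left_symmetric (levi_civita_product scale bracket \<omega>)
            \<longleftrightarrow> left_symmetric_L_algebra (levi_civita_product scale bracket \<omega>)) \<and>
         (left_symmetric_L_algebra (levi_civita_product scale bracket \<omega>)
            \<longleftrightarrow> novikov (left_symmetric_product bracket \<omega>)) \<and>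
         (novikov (left_symmetric_product bracket \<omega>)
            \<longleftrightarrow> associative (left_symmetric_product bracket \<omega>) \<and>
                associative (levi_civita_product scale bracket \<omega>))"
proof -
  interpret symplectic_lie_algebra scale Basis bracket \<omega> by (rule assms)
  show ?thesis
    using left_symmetric_L_algebra_levi_civita_iff novikov_if_levi_civita_left_symmetric
      novikov_if_associative associative_if_novikov associative_levi_civita_iff
    unfolding left_symmetric_L_algebra_def by blast
qed

end
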